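(* Let $\mathit{AGT}$ be a set of agents that is an initial subset $\{0,1,\ldots\}$ of $\mathbb{N}$ (possibly $\mathbb{N}$ itself). A formula of the language $\mathcal{L}_{\mathsf{CSTIT}}^{\mathit{AGT}}$ is valid in BT+AC structures if and only if it is provable from the axiom schemas S5($\Box$), S5($i$) (for every $i\in\mathit{AGT}$), ($\Box\to i$) (for every $i\in\mathit{AGT}$) and (AAIA$_k$) (for every $k\ge 1$, $k\in\mathit{AGT}$) by the rules of modus ponens and $\Box$-necessitation, where ($\Box\to i$) is the schema $\Box\varphi\to[i]\varphi$, and (AAIA$_k$) is the schema $\Diamond\varphi\to\langle k\rangle\bigwedge_{0\le i<k}\langle i\rangle\varphi$.
   Context: Language. $\mathit{ATM}$ is a countably infinite set of atomic propositions and $\mathit{AGT}$ is a set of agents, an initial subset $\{0,1,\ldots\}$ of $\mathbb{N}$ (possibly $\mathbb{N}$). $\mathcal{L}_{\mathsf{CSTIT}}^{\mathit{AGT}}$ is given by $\varphi ::= p\mid\lnot\varphi\mid(\varphi\land\varphi)\mid[i]\varphi\mid\Box\varphi$ with $p\in\mathit{ATM}$, $i\in\mathit{AGT}$; other boolean connectives are abbreviations, $\Diamond\varphi$ abbreviates $\lnot\Box\lnot\varphi$ and $\langle i\rangle\varphi$ abbreviates $\lnot[i]\lnot\varphi$. Semantics. A BT structure is $\langle W,<\rangle$ with $W$ a nonempty set of moments and $<$ a tree-like (strict partial) ordering: if $w_1<w_3$ and $w_2<w_3$ then $w_1=w_2$ or $w_1<w_2$ or $w_2<w_1$. A history is a maximal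 linearly ordered set of moments; $Hist$ is the set of histories and $H_w=\{h\in Hist: w\in h\}$. An index is a pair $w/h$ with $w\in W$, $h\in H_w$. A BT+AC model is $\mathcal{M}=\langle W,<,Choice,V\rangle$ where $\langle W,<\rangle$ is a BT structure, $V:\mathit{ATM}\to 2^{W\times Hist}$, and $Choice$ maps each agent $i$ and moment $w$ to a partition $Choice_i^w$ of $H_w$ such that $Choice_i^w\neq\emptyset$, every $Q\in Choice_i^w$ is nonempty, and for every $w$ and every map $s_w:\mathit{AGT}\to 2^{H_w}$ with $s_w(i)\in Choice_i^w$ for all $i$, $\bigcap_{i\in\mathit{AGT}}s_w(i)\neq\emptyset$. For $h\in H_w$, $Choice_i^w(h)$ is the member of $Choice_i^w$ containing $h$. Truth: $\mathcal{M},w/h\models p$ iff $w/h\in V(p)$; booleans as usual; $\mathcal{M},w/h\models\Box\varphi$ iff $\mathcal{M},w/h'\models\varphi$ for all $h'\in H_w$; $\mathcal{M},w/h\models[i]\varphi$ iff $\mathcal{M},w/h'\models\varphi$ for all $h'\in Choice_i^w(h)$. A formula is valid in BT+AC structures if it is true at every index of every BT+AC model. Axiomatics. S5($\Box$) (resp. S5($i$)) denotes the usual axiom schemas of the normal modal logic S5 for $\Box$ (resp. $[i]$), over classical propositional logic. $\Box$-necessitation: from $\varphi$ infer $\Box\varphi$. *)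

theory Defs
  imports Main "HOL-Library.Countable" "HOL-Library.Infinite_Typeclass" "HOL-Library.Disjoint_Sets"
begin

section \<open>Language\<close>

datatype 'p fm =
    Atom 'p
  | Neg "'p fm"
  | And "'p fm" "'p fm"
  | Stit nat "'p fm"
  | Box "'p fm"

text \<open>The type \<^typ>\<open>'p fm\<close> allows every natural number as an agent;
  \<open>lang AGT\<close> is the set of formulas whose agents all belong to \<open>AGT\<close>.\<close>

primrec agents :: "'p fm \<Rightarrow> nat set" where
  "agents (Atom p) = {}"
| "agents (Neg \<phi>) = agents \<phi>"
| "agents (And \<phi> \<psi>) = agents \<phi> \<union> agents \<psi>"
| "agents (Stit i \<phi>) = insert i (agents \<phi>)"
| "agents (Box \<phi>) = agents \<phi>"

definition lang :: "nat set \<Rightarrow> 'p fm set" where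
  "lang AGT = {\<phi>. agents \<phi> \<subseteq> AGT}"

abbreviation Imp :: "'p fm \<Rightarrow> 'p fm \<Rightarrow> 'p fm" where
  "Imp \<phi> \<psi> \<equiv> Neg (And \<phi> (Neg \<psi>))"

abbreviation Dia :: "'p fm \<Rightarrow> 'p fm" where
  "Dia \<phi> \<equiv> Neg (Box (Neg \<phi>))"

abbreviation DiaStit :: "nat \<Rightarrow> 'p fm \<Rightarrow> 'p fm" where
  "DiaStit i \<phi> \<equiv> Neg (Stit i (Neg \<phi>))"

text \<open>For \<open>k \<ge> 1\<close>, \<open>ConjBelow f k\<close> is the left-nested conjunction of
  \<open>f 0, \<dots>, f (k - 1)\<close>. It is only used for such \<open>k\<close>; empty conjunctions do not arise.\<close>

definition ConjBelow :: "(nat \<Rightarrow> 'p fm) \<Rightarrow> nat \<Rightarrow> 'p fm" where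
  "ConjBelow f k = foldl And (f 0) (map f [1..<k])"

definition initial_agents :: "nat set \<Rightarrow> bool" where
  "initial_agents AGT \<longleftrightarrow> (\<forall>i\<in>AGT. \<forall>j<i. j \<in> AGT)"


section \<open>Branching time with agents' choices\<close>

definition bt_structure :: "'w set \<Rightarrow> ('w \<Rightarrow> 'w \<Rightarrow> bool) \<Rightarrow> bool" where
  "bt_structure W lt \<longleftrightarrow>
     W \<noteq> {} \<and> irreflp_on W lt \<and> transp_on W lt \<and>
     (\<forall>w1\<in>W. \<forall>w2\<in>W. \<forall>w3\<in>W. lt w1 w3 \<and> lt w2 w3 \<longrightarrow> w1 = w2 \<or> lt w1 w2 \<or> lt w2 w1)"

text \<open>Chains in the sense of \<^theory>\<open>HOL.Zorn\<close> are taken with respect to the reflexive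
  closure of the given relation, so the strict order can be used directly.\<close>

definition Hist :: "'w set \<Rightarrow> ('w \<Rightarrow> 'w \<Rightarrow> bool) \<Rightarrow> 'w set set" where
  "Hist W lt = {h. pred_on.maxchain W lt h}"

definition Hist_at :: "'w set \<Rightarrow> ('w \<Rightarrow> 'w \<Rightarrow> bool) \<Rightarrow> 'w \<Rightarrow> 'w set set" where
  "Hist_at W lt w = {h \<in> Hist W lt. w \<in> h}"

record ('w, 'p) btac =
  Moments :: "'w set"
  Before :: "'w \<Rightarrow> 'w \<Rightarrow> bool"
  Choice :: "nat \<Rightarrow> 'w \<Rightarrow> 'w set set set"
  Val :: "'p \<Rightarrow> ('w \<times> 'w set) set"

abbreviation Histories :: "('w, 'p) btac \<Rightarrow> 'w set set" where
  "Histories M \<equiv> Hist (Moments M) (Before M)"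

abbreviation H_at :: "('w, 'p) btac \<Rightarrow> 'w \<Rightarrow> 'w set set" where
  "H_at M w \<equiv> Hist_at (Moments M) (Before M) w"

text \<open>Nonemptiness of the members of \<open>Choice M i w\<close> is part of \<^const>\<open>partition_on\<close>.\<close>

definition btac_model :: "nat set \<Rightarrow> ('w, 'p) btac \<Rightarrow> bool" where
  "btac_model AGT M \<longleftrightarrow>
     bt_structure (Moments M) (Before M) \<and>
     (\<forall>i\<in>AGT. \<forall>w\<in>Moments M. partition_on (H_at M w) (Choice M i w) \<and> Choice M i w \<noteq> {}) \<and>
     (\<forall>w\<in>Moments M. \<forall>s. (\<forall>i\<in>AGT. s i \<in> Choice M i w) \<longrightarrow> (\<Inter>i\<in>AGT. s i) \<noteq> {}) \<and>
     (\<forall>p. Val M p \<subseteq> Moments M \<times> Histories M)"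

definition choice_of :: "('w, 'p) btac \<Rightarrow> nat \<Rightarrow> 'w \<Rightarrow> 'w set \<Rightarrow> 'w set set" where
  "choice_of M i w h = (THE Q. Q \<in> Choice M i w \<and> h \<in> Q)"

primrec sat :: "('w, 'p) btac \<Rightarrow> 'w \<Rightarrow> 'w set \<Rightarrow> 'p fm \<Rightarrow> bool" where
  "sat M w h (Atom p) \<longleftrightarrow> (w, h) \<in> Val M p"
| "sat M w h (Neg \<phi>) \<longleftrightarrow> \<not> sat M w h \<phi>"
| "sat M w h (And \<phi> \<psi>) \<longleftrightarrow> sat M w h \<phi> \<and> sat M w h \<psi>"
| "sat M w h (Stit i \<phi>) \<longleftrightarrow> (\<forall>h'\<in>choice_of M i w h. sat M w h' \<phi>)"
| "sat M w h (Box \<phi>) \<longleftrightarrow> (\<forall>h'\<in>H_at M w. sat M w h' \<phi>)"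

text \<open>The type argument names the type from which the sets of moments are drawn. HOL cannot
  quantify over types inside a formula, so arbitrary models are covered by leaving this type a
  type variable.\<close>

definition btac_valid :: "'w itself \<Rightarrow> nat set \<Rightarrow> 'p fm \<Rightarrow> bool" where
  "btac_valid TYPE('w) AGT \<phi> \<longleftrightarrow>
     (\<forall>M :: ('w, 'p) btac. btac_model AGT M \<longrightarrow>
        (\<forall>w\<in>Moments M. \<forall>h\<in>H_at M w. sat M w h \<phi>))"


section \<open>Axiomatics\<close>

text \<open>Classical propositional logic: all instances of tautologies, where atoms and formulas
  with an outermost modal operator are treated as propositional letters.\<close>

primrec prop_eval :: "('p fm \<Rightarrow> bool) \<Rightarrow> 'p fm \<Rightarrow> bool" where
  "prop_eval v (Atom p) = v (Atom p)"
| "prop_eval v (Neg \<phi>) = (\<not> prop_eval v \<phi>)"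
| "prop_eval v (And \<phi> \<psi>) = (prop_eval v \<phi> \<and> prop_eval v \<psi>)"
| "prop_eval v (Stit i \<phi>) = v (Stit i \<phi>)"
| "prop_eval v (Box \<phi>) = v (Box \<phi>)"

definition tautology :: "'p fm \<Rightarrow> bool" where
  "tautology \<phi> \<longleftrightarrow> (\<forall>v. prop_eval v \<phi>)"

text \<open>S5 for a box-like operator \<open>N\<close>; its dual is written out as \<open>\<not> N \<not>\<close>.\<close>

inductive S5_axiom :: "('p fm \<Rightarrow> 'p fm) \<Rightarrow> 'p fm \<Rightarrow> bool" for N where
  K: "S5_axiom N (Imp (N (Imp \<phi> \<psi>)) (Imp (N \<phi>) (N \<psi>)))"
| T: "S5_axiom N (Imp (N \<phi>) \<phi>)"
| Five: "S5_axiom N (Imp (Neg (N (Neg \<phi>))) (N (Neg (N (Neg \<phi>)))))"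

inductive stit_axiom :: "nat set \<Rightarrow> 'p fm \<Rightarrow> bool" for AGT where
  Taut: "tautology \<phi> \<Longrightarrow> stit_axiom AGT \<phi>"
| S5_Box: "S5_axiom Box \<phi> \<Longrightarrow> stit_axiom AGT \<phi>"
| S5_Stit: "i \<in> AGT \<Longrightarrow> S5_axiom (Stit i) \<phi> \<Longrightarrow> stit_axiom AGT \<phi>"
| Box_Stit: "i \<in> AGT \<Longrightarrow> stit_axiom AGT (Imp (Box \<phi>) (Stit i \<phi>))"
| AAIA: "k \<in> AGT \<Longrightarrow> k \<ge> 1 \<Longrightarrow>
    stit_axiom AGT (Imp (Dia \<phi>) (DiaStit k (ConjBelow (\<lambda>i. DiaStit i \<phi>) k)))"

text \<open>Axiom instances are restricted to \<open>lang AGT\<close>, hence all formulas in a derivation lie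
  in \<open>lang AGT\<close>.\<close>

inductive provable :: "nat set \<Rightarrow> 'p fm \<Rightarrow> bool" for AGT where
  Axiom: "\<phi> \<in> lang AGT \<Longrightarrow> stit_axiom AGT \<phi> \<Longrightarrow> provable AGT \<phi>"
| MP: "provable AGT (Imp \<phi> \<psi>) \<Longrightarrow> provable AGT \<phi> \<Longrightarrow> provable AGT \<psi>"
| Nec: "provable AGT \<phi> \<Longrightarrow> provable AGT (Box \<phi>)"

end

theory Submission
  imports Defs "HOL-Library.Countable_Set"
begin

text \<open>Soundness of (AAIA\<open>\<^sub>k\<close>) is an instance of independence of agents.
  For completeness, only the agents \<open>0, \<dots>, n - 1\<close> up to the largest one in the formula matter: the
  other agents get vacuous choices. In the canonical model, (AAIA\<open>\<^sub>k\<close>) yields, for box-equivalent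
  \<open>u\<close> and \<open>v\<close>, some \<open>t\<close> that is \<open>k\<close>-equivalent to \<open>u\<close> and \<open>i\<close>-equivalent to \<open>v\<close> for all \<open>i < k\<close>;
  iterating this over \<open>k < n\<close> gives independence of the \<open>n\<close> agents. A Skolem hull cuts a box-class of
  the canonical model down to a countable set of worlds that keeps all witnesses. Its
  worlds become the leaves of a tree of height one: histories through the root correspond to worlds,
  and countability embeds the tree into any infinite type.\<close>

section \<open>Formulas and soundness\<close>

instance fm :: (countable) countable
  by countable_datatype

section \<open>Bounded conjunctions and the language of an agent set\<close>

lemma ConjBelow_1: "ConjBelow f (Suc 0) = f 0"
  by (simp add: ConjBelow_def)

lemma ConjBelow_Suc: "k \<ge> 1 \<Longrightarrow> ConjBelow f (Suc k) = And (ConjBelow f k) (f k)"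
  by (simp add: ConjBelow_def)

lemma agents_ConjBelow: "k \<ge> 1 \<Longrightarrow> agents (ConjBelow f k) = (\<Union>i<k. agents (f i))"
  by (induction k rule: nat_induct_at_least)
     (auto simp: ConjBelow_1 ConjBelow_Suc lessThan_Suc)

lemma sat_ConjBelow: "k \<ge> 1 \<Longrightarrow> sat M w h (ConjBelow f k) \<longleftrightarrow> (\<forall>i<k. sat M w h (f i))"
  by (induction k rule: nat_induct_at_least)
     (auto simp: ConjBelow_1 ConjBelow_Suc less_Suc_eq)

lemma lang_simps [simp]:
  "Atom p \<in> lang A"
  "Neg \<phi> \<in> lang A \<longleftrightarrow> \<phi> \<in> lang A"
  "And \<phi> \<psi> \<in> lang A \<longleftrightarrow> \<phi> \<in> lang A \<and> \<psi> \<in> lang A"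
  "Stit i \<phi> \<in> lang A \<longleftrightarrow> i \<in> A \<and> \<phi> \<in> lang A"
  "Box \<phi> \<in> lang A \<longleftrightarrow> \<phi> \<in> lang A"
  by (auto simp: lang_def)

lemma lang_ConjBelow [simp]: "k \<ge> 1 \<Longrightarrow> ConjBelow f k \<in> lang A \<longleftrightarrow> (\<forall>i<k. f i \<in> lang A)"
  by (auto simp: lang_def agents_ConjBelow)

lemma finite_agents: "finite (agents \<phi>)"
  by (induction \<phi>) auto

section \<open>Soundness of the axioms and rules\<close>

lemma prop_eval_sat: "prop_eval (sat M w h) \<phi> = sat M w h \<phi>"
  by (induction \<phi>) auto

lemma choice_of_eqI:
  assumes "partition_on H (Choice M i w)" "Q \<in> Choice M i w" "h \<in> Q"
  shows "choice_of M i w h = Q"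
  unfolding choice_of_def
proof (rule the_equality)
  fix Q' assume "Q' \<in> Choice M i w \<and> h \<in> Q'"
  then show "Q' = Q"
    using assms by (auto simp: partition_on_def disjoint_def)
qed (use assms in auto)

lemma choice_of_props:
  assumes "btac_model AGT M" "i \<in> AGT" "w \<in> Moments M" "h \<in> H_at M w"
  shows "choice_of M i w h \<in> Choice M i w" "h \<in> choice_of M i w h"
    "choice_of M i w h \<subseteq> H_at M w"
    "\<And>h'. h' \<in> choice_of M i w h \<Longrightarrow> choice_of M i w h' = choice_of M i w h"
proof -
  have P: "partition_on (H_at M w) (Choice M i w)"
    using assms by (auto simp: btac_model_def)
  then obtain Q where Q: "Q \<in> Choice M i w" "h \<in> Q"
    using assms(4) by (auto simp: partition_on_def)
  have eq: "choice_of M i w h' = Q" if "h' \<in> Q" for h'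
    using choice_of_eqI[OF P Q(1) that] .
  show "choice_of M i w h \<in> Choice M i w" "h \<in> choice_of M i w h"
    "choice_of M i w h \<subseteq> H_at M w"
    "\<And>h'. h' \<in> choice_of M i w h \<Longrightarrow> choice_of M i w h' = choice_of M i w h"
    using P Q eq by (auto simp: partition_on_def)
qed

lemma AAIA_sound:
  assumes M: "btac_model AGT M" "w \<in> Moments M" "h \<in> H_at M w"
    and AGT: "initial_agents AGT" "k \<in> AGT" "k \<ge> 1"
  shows "sat M w h (Imp (Dia \<phi>) (DiaStit k (ConjBelow (\<lambda>i. DiaStit i \<phi>) k)))"
proof -
  have "\<exists>h''\<in>choice_of M k w h. \<forall>i<k. \<exists>g\<in>choice_of M i w h''. sat M w g \<phi>"
    if h': "h' \<in> H_at M w" "sat M w h' \<phi>" for h'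
  proof -
    \<comment> \<open>Independence is applied to the profile in which \<open>k\<close> keeps its
      choice at \<open>h\<close> and everybody else takes the choice at \<open>h'\<close>. The
      common history \<open>g\<close> is the required \<open>h''\<close>: for \<open>i < k\<close>
      it shares a cell with \<open>h'\<close>, so \<open>h'\<close> is the witness for
      \<phi>.\<close>
    define s where "s i = choice_of M i w (if i = k then h else h')" for i
    have "\<forall>i\<in>AGT. s i \<in> Choice M i w"
      using choice_of_props(1)[OF M(1) _ M(2)] M(3) h'(1) by (auto simp: s_def)
    with M(1,2) have "(\<Inter>i\<in>AGT. s i) \<noteq> {}"
      by (auto simp: btac_model_def)
    then obtain g where g: "g \<in> s i" if "i \<in> AGT" for i
      by blast
    have "h' \<in> choice_of M i w g" if "i < k" for i
    proof -
      have i: "i \<in> AGT"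
        using AGT that by (auto simp: initial_agents_def)
      with g[OF this] that have "g \<in> choice_of M i w h'"
        by (simp add: s_def)
      then have "choice_of M i w g = choice_of M i w h'"
        by (rule choice_of_props(4)[OF M(1) i M(2) h'(1)])
      then show ?thesis
        using choice_of_props(2)[OF M(1) i M(2) h'(1)] by simp
    qed
    with g[OF AGT(2)] h'(2) show ?thesis
      by (auto simp: s_def)
  qed
  then show ?thesis
    using AGT(3) by (auto simp: sat_ConjBelow)
qed

lemma S5_Stit_sound:
  assumes "btac_model AGT M" "i \<in> AGT" "w \<in> Moments M" "h \<in> H_at M w"
    and "S5_axiom (Stit i) \<phi>"
  shows "sat M w h \<phi>"
  using assms(5)
proof cases
  case T
  then show ?thesis
    using choice_of_props(2)[OF assms(1-4)] by auto
next
  case Five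
  then show ?thesis
    using choice_of_props(4)[OF assms(1-4)] by (metis sat.simps(2-4))
qed auto

lemma stit_axiom_sound:
  assumes "stit_axiom AGT \<phi>" "initial_agents AGT"
    and "btac_model AGT M" "w \<in> Moments M" "h \<in> H_at M w"
  shows "sat M w h \<phi>"
  using assms(1)
proof cases
  case Taut
  \<comment> \<open>Truth at an index is itself a valuation of the propositional letters.\<close>
  then show ?thesis
    by (metis prop_eval_sat tautology_def)
next
  case S5_Box
  then show ?thesis
    using assms(5) by cases auto
next
  case (S5_Stit i)
  then show ?thesis
    by (intro S5_Stit_sound[OF assms(3) _ assms(4,5)])
next
  case (Box_Stit i \<psi>)
  then show ?thesis
    using choice_of_props(3)[OF assms(3) Box_Stit(2) assms(4,5)] by auto
next
  case (AAIA k \<psi>)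
  show ?thesis
    unfolding AAIA(1) by (rule AAIA_sound[OF assms(3-5,2) AAIA(2,3)])
qed

lemma provable_sound:
  assumes "provable AGT \<phi>" "initial_agents AGT" "btac_model AGT M"
    and "w \<in> Moments M" "h \<in> H_at M w"
  shows "sat M w h \<phi>"
  \<comment> \<open>The history must vary because necessitation passes to all histories through
    \<open>w\<close>.\<close>
  using assms by (induction arbitrary: h) (auto intro: stit_axiom_sound)


section \<open>Maximal consistent sets\<close>

lemma provable_lang: "provable A \<phi> \<Longrightarrow> \<phi> \<in> lang A"
  by (induction rule: provable.induct) auto

lemma stit_axiom_mono: "stit_axiom A \<phi> \<Longrightarrow> A \<subseteq> B \<Longrightarrow> stit_axiom B \<phi>"
  by (induction rule: stit_axiom.induct) (auto intro: stit_axiom.intros)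

text \<open>Completeness is proved for finitely many agents \<open>{..<n}\<close>; this transfers
  the resulting proof to \<open>AGT\<close>.\<close>

lemma provable_mono:
  assumes "provable A \<phi>" "A \<subseteq> B"
  shows "provable B \<phi>"
  using assms(1)
proof induction
  case (Axiom \<phi>)
  then show ?case
    using assms(2) stit_axiom_mono by (intro provable.Axiom) (auto simp: lang_def)
qed (auto intro: provable.intros)

lemma provable_taut: "\<phi> \<in> lang A \<Longrightarrow> tautology \<phi> \<Longrightarrow> provable A \<phi>"
  by (intro provable.Axiom stit_axiom.Taut)

text \<open>Necessitation is confined to theorems, which enter through \<open>Thm\<close>; with
  modus ponens as the only rule on hypotheses, the deduction theorem holds.\<close>

inductive derives :: "nat set \<Rightarrow> 'p fm set \<Rightarrow> 'p fm \<Rightarrow> bool" for A \<Gamma> where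
  Hyp: "\<phi> \<in> \<Gamma> \<Longrightarrow> derives A \<Gamma> \<phi>"
| Thm: "provable A \<phi> \<Longrightarrow> derives A \<Gamma> \<phi>"
| MP: "derives A \<Gamma> (Imp \<phi> \<psi>) \<Longrightarrow> derives A \<Gamma> \<phi> \<Longrightarrow> derives A \<Gamma> \<psi>"

lemma derives_lang: "derives A \<Gamma> \<phi> \<Longrightarrow> \<Gamma> \<subseteq> lang A \<Longrightarrow> \<phi> \<in> lang A"
  by (induction rule: derives.induct) (auto dest: provable_lang)

lemma derives_mono: "derives A \<Gamma> \<phi> \<Longrightarrow> \<Gamma> \<subseteq> \<Delta> \<Longrightarrow> derives A \<Delta> \<phi>"
  by (induction rule: derives.induct) (auto intro: derives.intros)

lemma derives_empty: "derives A {} \<phi> \<Longrightarrow> provable A \<phi>"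
  by (induction rule: derives.induct) (auto intro: provable.intros)

lemma derives_taut: "\<phi> \<in> lang A \<Longrightarrow> tautology \<phi> \<Longrightarrow> derives A \<Gamma> \<phi>"
  by (intro derives.Thm provable_taut)

lemma derives_taut1:
  assumes "derives A \<Gamma> \<phi>" "tautology (Imp \<phi> \<psi>)" "\<Gamma> \<subseteq> lang A" "\<psi> \<in> lang A"
  shows "derives A \<Gamma> \<psi>"
  using assms derives_lang by (intro derives.MP[OF derives_taut assms(1)]) auto

lemma derives_taut2:
  assumes "derives A \<Gamma> \<phi>" "derives A \<Gamma> \<chi>" "tautology (Imp \<phi> (Imp \<chi> \<psi>))"
    and "\<Gamma> \<subseteq> lang A" "\<psi> \<in> lang A"
  shows "derives A \<Gamma> \<psi>"
proof (rule derives.MP[OF derives.MP[OF derives_taut assms(1)] assms(2)])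
  show "Imp \<phi> (Imp \<chi> \<psi>) \<in> lang A"
    using assms derives_lang by auto
qed (fact assms(3))

lemma deduction:
  assumes "derives A (insert \<psi> \<Gamma>) \<phi>" "\<psi> \<in> lang A" "\<Gamma> \<subseteq> lang A"
  shows "derives A \<Gamma> (Imp \<psi> \<phi>)"
  using assms(1)
proof induction
  case (Hyp \<phi>)
  show ?case
  proof (cases "\<phi> = \<psi>")
    case True
    then show ?thesis
      using assms by (intro derives_taut) (auto simp: tautology_def)
  next
    case False
    with Hyp have "\<phi> \<in> \<Gamma>" by auto
    then show ?thesis
      using assms by (intro derives_taut1[OF derives.Hyp[of \<phi>]]) (auto simp: tautology_def)
  qed
next
  case (Thm \<phi>)
  then show ?case
    using assms by (intro derives_taut1[OF derives.Thm[of _ \<phi>]])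
      (auto simp: tautology_def dest: provable_lang)
next
  case (MP \<phi> \<chi>)
  have "\<chi> \<in> lang A"
    using MP.hyps(1) derives_lang assms(2,3) by fastforce
  then show ?case
    using assms by (intro derives_taut2[OF MP.IH]) (auto simp: tautology_def)
qed

section \<open>Consistency and Lindenbaum's lemma\<close>

definition consistent :: "nat set \<Rightarrow> 'p fm set \<Rightarrow> bool" where
  "consistent A \<Gamma> \<longleftrightarrow> (\<forall>\<chi>. \<not> (derives A \<Gamma> \<chi> \<and> derives A \<Gamma> (Neg \<chi>)))"

lemma inconsistent_insert:
  assumes "\<not> consistent A (insert \<phi> \<Gamma>)" "\<phi> \<in> lang A" "\<Gamma> \<subseteq> lang A"
  shows "derives A \<Gamma> (Neg \<phi>)"
proof -
  obtain \<chi> where "derives A (insert \<phi> \<Gamma>) \<chi>" "derives A (insert \<phi> \<Gamma>) (Neg \<chi>)"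
    using assms(1) by (auto simp: consistent_def)
  then have *: "derives A \<Gamma> (Imp \<phi> \<chi>)" "derives A \<Gamma> (Imp \<phi> (Neg \<chi>))"
    using deduction assms(2,3) by blast+
  show ?thesis
    using assms(2,3) by (intro derives_taut2[OF *]) (auto simp: tautology_def)
qed

lemma inconsistent_insert_Neg:
  assumes "\<not> consistent A (insert (Neg \<phi>) \<Gamma>)" "\<phi> \<in> lang A" "\<Gamma> \<subseteq> lang A"
  shows "derives A \<Gamma> \<phi>"
  using assms by (intro derives_taut1[OF inconsistent_insert[OF assms(1)]]) (auto simp: tautology_def)

definition mcs :: "nat set \<Rightarrow> 'p fm set \<Rightarrow> bool" where
  "mcs A \<Gamma> \<longleftrightarrow> \<Gamma> \<subseteq> lang A \<and> consistent A \<Gamma> \<and>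
     (\<forall>\<phi>\<in>lang A. \<phi> \<notin> \<Gamma> \<longrightarrow> \<not> consistent A (insert \<phi> \<Gamma>))"

text \<open>Derivations are finite: at each modus ponens the chain members serving the two premises
  are comparable, and the larger one serves both.\<close>

lemma derives_Union_chain:
  assumes "derives A (\<Union>\<C>) \<phi>" "subset.chain \<S> \<C>" "\<C> \<noteq> {}"
  shows "\<exists>\<Gamma>\<in>\<C>. derives A \<Gamma> \<phi>"
  using assms(1)
proof induction
  case (MP \<phi> \<psi>)
  then obtain \<Gamma> \<Delta> where *: "\<Gamma> \<in> \<C>" "derives A \<Gamma> (Imp \<phi> \<psi>)" "\<Delta> \<in> \<C>" "derives A \<Delta> \<phi>"
    by blast
  then have "\<Gamma> \<subseteq> \<Delta> \<or> \<Delta> \<subseteq> \<Gamma>"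
    using assms(2) by (auto simp: subset_chain_def)
  then show ?case
    using * by (meson derives.MP derives_mono)
qed (use assms(3) in \<open>auto intro: derives.intros\<close>)

lemma consistent_Union_chain:
  assumes "subset.chain {\<Delta>. consistent A \<Delta> \<and> P \<Delta>} \<C>" "\<C> \<noteq> {}"
  shows "consistent A (\<Union>\<C>)"
  unfolding consistent_def
proof (intro allI notI, elim conjE)
  fix \<chi> assume "derives A (\<Union>\<C>) \<chi>" "derives A (\<Union>\<C>) (Neg \<chi>)"
  then obtain \<Gamma> \<Delta> where *: "\<Gamma> \<in> \<C>" "derives A \<Gamma> \<chi>" "\<Delta> \<in> \<C>" "derives A \<Delta> (Neg \<chi>)"
    using derives_Union_chain[OF _ assms] by blast
  then have "\<Gamma> \<subseteq> \<Delta> \<or> \<Delta> \<subseteq> \<Gamma>"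
    using assms(1) by (auto simp: subset_chain_def)
  then have "\<exists>\<Theta>\<in>\<C>. \<not> consistent A \<Theta>"
    using * derives_mono unfolding consistent_def by blast
  then show False
    using assms(1) by (auto simp: subset.chain_def)
qed

text \<open>Zorn's lemma on the consistent extensions of \<Gamma> inside \<open>lang A\<close>;
  unions of chains stay consistent because a contradiction already arises in one member.\<close>

lemma lindenbaum:
  assumes "consistent A \<Gamma>" "\<Gamma> \<subseteq> lang A"
  obtains \<Delta> where "mcs A \<Delta>" "\<Gamma> \<subseteq> \<Delta>"
proof -
  let ?S = "{\<Delta>. consistent A \<Delta> \<and> \<Gamma> \<subseteq> \<Delta> \<and> \<Delta> \<subseteq> lang A}"
  have "\<exists>\<Delta>\<in>?S. \<forall>X\<in>?S. \<Delta> \<subseteq> X \<longrightarrow> X = \<Delta>"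
  proof (rule subset_Zorn_nonempty)
    fix \<C> assume \<C>: "\<C> \<noteq> {}" "subset.chain ?S \<C>"
    then have "\<forall>\<Delta>\<in>\<C>. \<Gamma> \<subseteq> \<Delta> \<and> \<Delta> \<subseteq> lang A"
      by (auto simp: subset.chain_def)
    with \<C> consistent_Union_chain[OF \<C>(2,1)] show "\<Union>\<C> \<in> ?S"
      by blast
  qed (use assms in auto)
  then obtain \<Delta> where \<Delta>: "\<Delta> \<in> ?S" and max: "\<forall>X\<in>?S. \<Delta> \<subseteq> X \<longrightarrow> X = \<Delta>"
    by (elim bexE)
  have "mcs A \<Delta>"
    unfolding mcs_def
  proof (intro conjI ballI impI notI)
    fix \<phi> assume "\<phi> \<in> lang A" "\<phi> \<notin> \<Delta>" "consistent A (insert \<phi> \<Delta>)"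
    then show False
      using bspec[OF max, of "insert \<phi> \<Delta>"] \<Delta> by auto
  qed (use \<Delta> in auto)
  with \<Delta> that show thesis by blast
qed

section \<open>Membership in maximal consistent sets\<close>

lemma mcs_subset_lang: "mcs A \<Gamma> \<Longrightarrow> \<phi> \<in> \<Gamma> \<Longrightarrow> \<phi> \<in> lang A"
  by (auto simp: mcs_def)

lemma mcs_not_both: "mcs A \<Gamma> \<Longrightarrow> \<phi> \<in> \<Gamma> \<Longrightarrow> Neg \<phi> \<notin> \<Gamma>"
  by (auto simp: mcs_def consistent_def intro: derives.Hyp)

lemma mcs_derives:
  assumes "mcs A \<Gamma>" "derives A \<Gamma> \<phi>"
  shows "\<phi> \<in> \<Gamma>"
proof (rule ccontr)
  assume "\<phi> \<notin> \<Gamma>"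
  moreover have "\<phi> \<in> lang A"
    using assms derives_lang by (auto simp: mcs_def)
  ultimately have "derives A \<Gamma> (Neg \<phi>)"
    using assms(1) by (intro inconsistent_insert) (auto simp: mcs_def)
  with assms show False
    by (auto simp: mcs_def consistent_def)
qed

lemma mcs_provable: "mcs A \<Gamma> \<Longrightarrow> provable A \<phi> \<Longrightarrow> \<phi> \<in> \<Gamma>"
  by (intro mcs_derives derives.Thm)

lemma mcs_Neg:
  assumes "mcs A \<Gamma>" "\<phi> \<in> lang A"
  shows "Neg \<phi> \<in> \<Gamma> \<longleftrightarrow> \<phi> \<notin> \<Gamma>"
proof
  assume "\<phi> \<notin> \<Gamma>"
  with assms have "derives A \<Gamma> (Neg \<phi>)"
    by (intro inconsistent_insert) (auto simp: mcs_def)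
  with assms(1) show "Neg \<phi> \<in> \<Gamma>"
    by (rule mcs_derives)
qed (use mcs_not_both[OF assms(1)] in auto)

lemma mcs_MP: "mcs A \<Gamma> \<Longrightarrow> Imp \<phi> \<psi> \<in> \<Gamma> \<Longrightarrow> \<phi> \<in> \<Gamma> \<Longrightarrow> \<psi> \<in> \<Gamma>"
  by (meson mcs_derives derives.intros)

lemma mcs_And:
  assumes "mcs A \<Gamma>"
  shows "And \<phi> \<psi> \<in> \<Gamma> \<longleftrightarrow> \<phi> \<in> \<Gamma> \<and> \<psi> \<in> \<Gamma>"
proof
  assume And: "And \<phi> \<psi> \<in> \<Gamma>"
  then have "\<phi> \<in> lang A" "\<psi> \<in> lang A"
    using mcs_subset_lang[OF assms] by fastforce+
  then have "provable A (Imp (And \<phi> \<psi>) \<phi>)" "provable A (Imp (And \<phi> \<psi>) \<psi>)"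
    by (auto intro!: provable_taut simp: tautology_def)
  then show "\<phi> \<in> \<Gamma> \<and> \<psi> \<in> \<Gamma>"
    using And assms mcs_provable mcs_MP by blast
next
  assume *: "\<phi> \<in> \<Gamma> \<and> \<psi> \<in> \<Gamma>"
  then have "provable A (Imp \<phi> (Imp \<psi> (And \<phi> \<psi>)))"
    using mcs_subset_lang[OF assms] by (auto intro!: provable_taut simp: tautology_def)
  then show "And \<phi> \<psi> \<in> \<Gamma>"
    using * assms mcs_provable mcs_MP by blast
qed

lemma mcs_ConjBelow: "k \<ge> 1 \<Longrightarrow> mcs A \<Gamma> \<Longrightarrow> ConjBelow f k \<in> \<Gamma> \<longleftrightarrow> (\<forall>i<k. f i \<in> \<Gamma>)"
  by (induction k rule: nat_induct_at_least)
     (auto simp: ConjBelow_1 ConjBelow_Suc less_Suc_eq mcs_And)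


section \<open>The canonical relations\<close>

text \<open>Treating the modalities uniformly lets the S5 arguments about canonical relations be
  carried out once for \<open>Box\<close> and all \<open>Stit i\<close>.\<close>

definition boxes :: "nat set \<Rightarrow> ('p fm \<Rightarrow> 'p fm) set" where
  "boxes A = insert Box (Stit ` A)"

lemma boxes_lang: "N \<in> boxes A \<Longrightarrow> N \<phi> \<in> lang A \<longleftrightarrow> \<phi> \<in> lang A"
  by (auto simp: boxes_def)

lemma boxes_S5:
  assumes "N \<in> boxes A" "S5_axiom N \<phi>" "\<phi> \<in> lang A"
  shows "provable A \<phi>"
  using assms by (auto simp: boxes_def intro!: provable.Axiom intro: stit_axiom.intros)

lemma provable_Box_Stit: "i \<in> A \<Longrightarrow> \<phi> \<in> lang A \<Longrightarrow> provable A (Imp (Box \<phi>) (Stit i \<phi>))"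
  by (auto intro!: provable.Axiom intro: stit_axiom.intros)

text \<open>For \<open>Stit i\<close>, necessitation is derived: necessitate with
  \<open>Box\<close>, then apply the axiom from \<open>Box\<close> to \<open>Stit i\<close>.\<close>

lemma boxes_nec:
  assumes "N \<in> boxes A" "provable A \<phi>"
  shows "provable A (N \<phi>)"
  using assms provable.Nec[OF assms(2)] provable_lang[OF assms(2)]
  by (auto simp: boxes_def intro: provable.MP[OF provable_Box_Stit])

lemma mcs_K:
  assumes "mcs A u" "N \<in> boxes A" "N (Imp \<phi> \<psi>) \<in> u" "N \<phi> \<in> u"
  shows "N \<psi> \<in> u"
proof -
  have "\<phi> \<in> lang A" "\<psi> \<in> lang A"
    using mcs_subset_lang[OF assms(1,3)] boxes_lang[OF assms(2)] by auto
  then have "provable A (Imp (N (Imp \<phi> \<psi>)) (Imp (N \<phi>) (N \<psi>)))"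
    using assms(2) by (intro boxes_S5[OF assms(2) S5_axiom.K]) (auto simp: boxes_lang)
  then show ?thesis
    using assms mcs_provable mcs_MP by blast
qed

definition canon :: "('p fm \<Rightarrow> 'p fm) \<Rightarrow> 'p fm set \<Rightarrow> 'p fm set \<Rightarrow> bool" where
  "canon N u v \<longleftrightarrow> (\<forall>\<psi>. N \<psi> \<in> u \<longrightarrow> \<psi> \<in> v)"

lemma canon_refl:
  assumes "mcs A u" "N \<in> boxes A"
  shows "canon N u u"
  unfolding canon_def
proof (intro allI impI)
  fix \<psi> assume "N \<psi> \<in> u"
  moreover have "provable A (Imp (N \<psi>) \<psi>)"
    using mcs_subset_lang[OF assms(1) \<open>N \<psi> \<in> u\<close>] assms(2)
    by (intro boxes_S5[OF assms(2) S5_axiom.T]) (auto simp: boxes_lang)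
  ultimately show "\<psi> \<in> u"
    using assms mcs_provable mcs_MP by blast
qed

text \<open>This is what axiom \<open>Five\<close> expresses. Together with reflexivity it yields
  symmetry and transitivity.\<close>

lemma canon_euclidean:
  assumes m: "mcs A u" "mcs A v" "mcs A t" and N: "N \<in> boxes A"
    and "canon N u v" "canon N u t"
  shows "canon N v t"
  unfolding canon_def
proof (intro allI impI, rule ccontr)
  fix \<psi> assume "N \<psi> \<in> v" "\<psi> \<notin> t"
  have L: "\<psi> \<in> lang A"
    using mcs_subset_lang[OF m(2) \<open>N \<psi> \<in> v\<close>] boxes_lang[OF N] by auto
  \<comment> \<open>\<open>Five\<close> is used for \<open>Neg \<psi>\<close>, whose diamond is
    \<open>Neg ?\<phi>\<close>. The double negation is bridged at the end by necessitating a
    tautology and applying K.\<close>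
  let ?\<phi> = "N (Neg (Neg \<psi>))"
  have "?\<phi> \<notin> u"
    using \<open>\<psi> \<notin> t\<close> \<open>canon N u t\<close> L m(3) by (auto simp: canon_def mcs_Neg)
  then have "Neg ?\<phi> \<in> u"
    using m(1) L N by (simp add: mcs_Neg boxes_lang)
  moreover have "provable A (Imp (Neg ?\<phi>) (N (Neg ?\<phi>)))"
    using L N by (intro boxes_S5[OF N S5_axiom.Five]) (auto simp: boxes_lang)
  ultimately have "N (Neg ?\<phi>) \<in> u"
    using m(1) mcs_provable mcs_MP by blast
  then have "?\<phi> \<notin> v"
    using \<open>canon N u v\<close> m(2) mcs_not_both by (auto simp: canon_def)
  moreover have "provable A (N (Imp \<psi> (Neg (Neg \<psi>))))"
    using L by (intro boxes_nec[OF N] provable_taut) (auto simp: tautology_def)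
  ultimately show False
    using \<open>N \<psi> \<in> v\<close> m(2) N mcs_K mcs_provable by blast
qed

lemma canon_sym: "mcs A u \<Longrightarrow> mcs A v \<Longrightarrow> N \<in> boxes A \<Longrightarrow> canon N u v \<Longrightarrow> canon N v u"
  using canon_euclidean canon_refl by blast

lemma canon_trans:
  "mcs A u \<Longrightarrow> mcs A v \<Longrightarrow> mcs A t \<Longrightarrow> N \<in> boxes A \<Longrightarrow> canon N u v \<Longrightarrow> canon N v t \<Longrightarrow> canon N u t"
  using canon_euclidean canon_sym by blast

lemma canon_Stit_imp_Box:
  assumes "mcs A u" "i \<in> A" "canon (Stit i) u v"
  shows "canon Box u v"
  unfolding canon_def
proof (intro allI impI)
  fix \<psi> assume "Box \<psi> \<in> u"
  moreover from this have "provable A (Imp (Box \<psi>) (Stit i \<psi>))"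
    using assms(1,2) mcs_subset_lang by (intro provable_Box_Stit) fastforce+
  ultimately show "\<psi> \<in> v"
    using assms mcs_provable mcs_MP unfolding canon_def by blast
qed

lemma canon_witness:
  assumes u: "mcs A u" and N: "N \<in> boxes A" and \<psi>: "\<psi> \<in> lang A" "N \<psi> \<notin> u"
  obtains v where "mcs A v" "canon N u v" "\<psi> \<notin> v"
proof -
  let ?X = "{\<chi>. N \<chi> \<in> u}"
  have X: "?X \<subseteq> lang A"
    using mcs_subset_lang[OF u] boxes_lang[OF N] by auto
  \<comment> \<open>By necessitation and K, whatever follows from \<open>?X\<close> is boxed in
    \<open>u\<close>. Hence \<psi> does not follow, and \<open>Neg \<psi>\<close> can be added
    consistently.\<close>
  have "N \<theta> \<in> u" if "derives A ?X \<theta>" for \<theta>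
    using that
  proof induction
    case (Thm \<phi>)
    then show ?case
      using u N boxes_nec mcs_provable by blast
  next
    case (MP \<phi> \<chi>)
    then show ?case
      using u N mcs_K by blast
  qed simp
  with \<psi> X have "consistent A (insert (Neg \<psi>) ?X)"
    using inconsistent_insert_Neg by blast
  then obtain v where "mcs A v" "insert (Neg \<psi>) ?X \<subseteq> v"
    using lindenbaum X \<psi>(1) by (metis insert_subset lang_simps(2))
  with that show thesis
    using mcs_not_both unfolding canon_def by blast
qed

lemma canon_witness_dual:
  assumes "mcs A u" "N \<in> boxes A" "Neg (N (Neg \<psi>)) \<in> u"
  obtains v where "mcs A v" "canon N u v" "\<psi> \<in> v"
proof -
  have L: "\<psi> \<in> lang A"
    using mcs_subset_lang[OF assms(1,3)] assms(2) by (simp add: boxes_lang)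
  moreover have "N (Neg \<psi>) \<notin> u"
    using assms mcs_not_both by blast
  ultimately obtain v where "mcs A v" "canon N u v" "Neg \<psi> \<notin> v"
    using canon_witness assms by (metis lang_simps(2))
  with that L show thesis
    using mcs_Neg by blast
qed

lemma canon_AAIA:
  assumes A: "initial_agents A" "k \<in> A" "k \<ge> 1"
    and w: "mcs A w" and v: "mcs A v" and wv: "canon Box w v"
  obtains u where "mcs A u" "canon (Stit k) w u" "\<And>i. i < k \<Longrightarrow> canon (Stit i) v u"
proof -
  have bx: "Stit i \<in> boxes A" if "i \<le> k" for i
    using A that by (auto simp: boxes_def initial_agents_def le_less)
  \<comment> \<open>Approximate solutions: instead of \<open>v\<close> itself, each agent below
    \<open>k\<close> only needs to reach from \<open>u\<close> some world sharing the single formula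
    \<phi> with \<open>v\<close>. \<open>AAIA\<close> makes \<open>Z \<phi>\<close> nonempty for
    every \<phi> in \<open>v\<close>.\<close>
  define Z where "Z \<phi> = {u. mcs A u \<and> canon (Stit k) w u \<and>
    (\<forall>i<k. \<exists>v'. mcs A v' \<and> canon (Stit i) u v' \<and> \<phi> \<in> v')}" for \<phi>
  have Z_nonempty: "Z \<phi> \<noteq> {}" if "\<phi> \<in> v" for \<phi>
  proof -
    have L: "\<phi> \<in> lang A"
      using v that mcs_subset_lang by blast
    have "Box (Neg \<phi>) \<notin> w"
      using wv v that mcs_not_both unfolding canon_def by blast
    then have "Dia \<phi> \<in> w"
      using L by (simp add: mcs_Neg[OF w])
    moreover have "provable A (Imp (Dia \<phi>) (DiaStit k (ConjBelow (\<lambda>i. DiaStit i \<phi>) k)))"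
    proof (rule provable.Axiom)
      show "Imp (Dia \<phi>) (DiaStit k (ConjBelow (\<lambda>i. DiaStit i \<phi>) k)) \<in> lang A"
        using A L by (auto simp: initial_agents_def)
    qed (use A in \<open>intro stit_axiom.AAIA\<close>)
    ultimately have "DiaStit k (ConjBelow (\<lambda>i. DiaStit i \<phi>) k) \<in> w"
      using w mcs_provable mcs_MP by blast
    then obtain u where u: "mcs A u" "canon (Stit k) w u" "ConjBelow (\<lambda>i. DiaStit i \<phi>) k \<in> u"
      using canon_witness_dual w bx by blast
    then have "\<forall>i<k. DiaStit i \<phi> \<in> u"
      using A(3) by (simp add: mcs_ConjBelow)
    then have "\<forall>i<k. \<exists>v'. mcs A v' \<and> canon (Stit i) u v' \<and> \<phi> \<in> v'"
      using canon_witness_dual[OF u(1)] bx by (metis less_imp_le)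
    with u have "u \<in> Z \<phi>"
      by (simp add: Z_def)
    then show ?thesis by blast
  qed
  have Z_And: "u \<in> Z \<phi>" "u \<in> Z \<psi>" "mcs A u" if "u \<in> Z (And \<phi> \<psi>)" for u \<phi> \<psi>
    using that mcs_And unfolding Z_def by blast+
  \<comment> \<open>The maximal consistent sets containing \<open>X\<close> are exactly the worlds
    sought, so it suffices that \<open>X\<close> is consistent.\<close>
  define X where "X = {\<chi>. Stit k \<chi> \<in> w} \<union> {\<chi>. \<exists>i<k. Stit i \<chi> \<in> v}"
  have X: "X \<subseteq> lang A"
    using mcs_subset_lang[OF w] mcs_subset_lang[OF v] by (fastforce simp: X_def)
  \<comment> \<open>Replaces compactness: the finitely many hypotheses from \<open>v\<close> used in a derivation are collected
    into a single formula \<open>\<phi>\<close>, to which (AAIA\<open>\<^sub>k\<close>) applies.\<close>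
  have Z_derives: "\<exists>\<phi>\<in>v. \<forall>u\<in>Z \<phi>. \<theta> \<in> u" if "derives A X \<theta>" for \<theta>
    using that
  proof induction
    case (Hyp \<theta>)
    then consider "Stit k \<theta> \<in> w" | i where "i < k" "Stit i \<theta> \<in> v"
      by (auto simp: X_def)
    then show ?case
    proof cases
      case 1
      \<comment> \<open>Any member of \<open>v\<close> will do here; a tautology over an arbitrary
        atom shows that there is one.\<close>
      obtain \<phi> where "\<phi> \<in> v"
        using mcs_provable[OF v] provable_taut[of "Imp (Atom undefined) (Atom undefined)"]
        by (auto simp: tautology_def)
      with 1 show ?thesis
        by (auto simp: Z_def canon_def)
    next
      case 2
      \<comment> \<open>\<open>Stit i \<theta>\<close> itself is the chosen formula:
        \<open>u\<close> reaches a world \<open>v'\<close> containing it, and by symmetry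
        \<open>v'\<close> passes \<theta> back to \<open>u\<close>.\<close>
      have "\<theta> \<in> u" if u: "u \<in> Z (Stit i \<theta>)" for u
      proof -
        obtain v' where v': "mcs A v'" "canon (Stit i) u v'" "Stit i \<theta> \<in> v'" and "mcs A u"
          using u 2(1) by (auto simp: Z_def)
        then have "canon (Stit i) v' u"
          using canon_sym bx 2(1) by (meson less_imp_le)
        with v'(3) show ?thesis
          by (auto simp: canon_def)
      qed
      with 2(2) show ?thesis by blast
    qed
  next
    case (Thm \<theta>)
    obtain \<phi> where "\<phi> \<in> v"
      using mcs_provable[OF v Thm] by blast
    moreover have "\<forall>u\<in>Z \<phi>. \<theta> \<in> u"
      using mcs_provable[OF _ Thm] by (simp add: Z_def)
    ultimately show ?case by blast
  next
    case (MP \<theta> \<chi>)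
    then obtain \<phi> \<psi> where "\<phi> \<in> v" "\<psi> \<in> v"
      and *: "\<forall>u\<in>Z \<phi>. Imp \<theta> \<chi> \<in> u" "\<forall>u\<in>Z \<psi>. \<theta> \<in> u"
      by blast
    then have "And \<phi> \<psi> \<in> v"
      using mcs_And[OF v] by blast
    moreover have "\<chi> \<in> u" if "u \<in> Z (And \<phi> \<psi>)" for u
    proof -
      have "Imp \<theta> \<chi> \<in> u" "\<theta> \<in> u"
        using * Z_And(1,2)[OF that] by blast+
      then show ?thesis
        by (rule mcs_MP[OF Z_And(3)[OF that]])
    qed
    ultimately show ?case by blast
  qed
  \<comment> \<open>A contradiction from \<open>X\<close> would put \<chi> and
    \<open>Neg \<chi>\<close> into every member of the nonempty set
    \<open>Z (And \<phi> \<psi>)\<close>.\<close>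
  have "consistent A X"
    unfolding consistent_def
  proof (intro allI notI, elim conjE)
    fix \<chi> assume "derives A X \<chi>" "derives A X (Neg \<chi>)"
    then obtain \<phi> \<psi> where \<phi>: "\<phi> \<in> v" "\<forall>u\<in>Z \<phi>. \<chi> \<in> u" and \<psi>: "\<psi> \<in> v" "\<forall>u\<in>Z \<psi>. Neg \<chi> \<in> u"
      using Z_derives by meson
    then have "And \<phi> \<psi> \<in> v"
      using mcs_And[OF v] by blast
    then obtain u where u: "u \<in> Z (And \<phi> \<psi>)"
      using Z_nonempty by blast
    have "\<chi> \<in> u" "Neg \<chi> \<in> u"
      using \<phi>(2) \<psi>(2) Z_And(1,2)[OF u] by blast+
    then show False
      using mcs_not_both[OF Z_And(3)[OF u]] by blast
  qed
  then obtain u where "mcs A u" "X \<subseteq> u"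
    using lindenbaum X by blast
  with that show thesis
    unfolding X_def canon_def by blast
qed


section \<open>Countable Kripke models\<close>

text \<open>A downward Loewenheim-Skolem argument: \<open>{x}\<close> is closed under chosen
  witnesses in countably many rounds. Conditions have two parameters because the independence step
  starts from two worlds.\<close>

lemma countable_skolem_hull:
  fixes \<P> :: "('a \<Rightarrow> 'a \<Rightarrow> 'a \<Rightarrow> bool) set"
  assumes "countable \<P>" "x \<in> S"
  obtains C where "countable C" "x \<in> C" "C \<subseteq> S"
    "\<forall>P\<in>\<P>. \<forall>a\<in>C. \<forall>b\<in>C. \<forall>c\<in>S. P a b c \<longrightarrow> (\<exists>c\<in>C. P a b c)"
proof -
  \<comment> \<open>The default \<open>x\<close> keeps the Skolem function inside \<open>S\<close>
    where no witness exists.\<close>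
  define g :: "('a \<Rightarrow> 'a \<Rightarrow> 'a \<Rightarrow> bool) \<times> 'a \<times> 'a \<Rightarrow> 'a"
    where "g = (\<lambda>(P, a, b). if \<exists>c\<in>S. P a b c then SOME c. c \<in> S \<and> P a b c else x)"
  define D where "D n = ((\<lambda>X. X \<union> g ` (\<P> \<times> X \<times> X)) ^^ n) {x}" for n
  have D: "D 0 = {x}" "D (Suc n) = D n \<union> g ` (\<P> \<times> D n \<times> D n)" for n
    by (simp_all add: D_def)
  have g: "g (P, a, b) \<in> S" "c \<in> S \<Longrightarrow> P a b c \<Longrightarrow> P a b (g (P, a, b))" for P a b c
    using someI_ex[of "\<lambda>c. c \<in> S \<and> P a b c"] assms(2) by (auto simp: g_def)
  have mono: "D m \<subseteq> D n" if "m \<le> n" for m n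
    using that by (rule lift_Suc_mono_le[rotated]) (simp add: D)
  show thesis
  proof (rule that)
    have "countable (D n)" for n
      using assms(1) by (induction n) (auto simp: D)
    then show "countable (\<Union>n. D n)"
      by blast
    show "x \<in> (\<Union>n. D n)"
      using D(1) by blast
    have "D n \<subseteq> S" for n
      using assms(2) g(1) by (induction n) (auto simp: D)
    then show "(\<Union>n. D n) \<subseteq> S"
      by blast
    show "\<forall>P\<in>\<P>. \<forall>a\<in>\<Union>n. D n. \<forall>b\<in>\<Union>n. D n. \<forall>c\<in>S. P a b c \<longrightarrow> (\<exists>c\<in>\<Union>n. D n. P a b c)"
    proof (intro ballI impI)
      fix P a b c assume "a \<in> (\<Union>n. D n)" "b \<in> (\<Union>n. D n)" and P: "P \<in> \<P>" "c \<in> S" "P a b c"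
      then obtain m n where "a \<in> D m" "b \<in> D n"
        by blast
      moreover have "D m \<subseteq> D (max m n)" "D n \<subseteq> D (max m n)"
        by (simp_all add: mono)
      ultimately have "a \<in> D (max m n)" "b \<in> D (max m n)"
        by blast+
      with P(1) have "g (P, a, b) \<in> D (Suc (max m n))"
        by (auto simp: D)
      with g(2) P(2,3) show "\<exists>c\<in>\<Union>n. D n. P a b c"
        by blast
    qed
  qed
qed

text \<open>\<open>Box\<close> is the universal modality on \<open>C\<close>, as the countermodels
  lie within one box-class and come to represent the histories through one moment.\<close>

primrec ksat :: "'a set \<Rightarrow> (nat \<Rightarrow> 'a \<Rightarrow> 'a \<Rightarrow> bool) \<Rightarrow> ('p \<Rightarrow> 'a set) \<Rightarrow> 'a \<Rightarrow> 'p fm \<Rightarrow> bool" where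
  "ksat C R V u (Atom p) \<longleftrightarrow> u \<in> V p"
| "ksat C R V u (Neg \<phi>) \<longleftrightarrow> \<not> ksat C R V u \<phi>"
| "ksat C R V u (And \<phi> \<psi>) \<longleftrightarrow> ksat C R V u \<phi> \<and> ksat C R V u \<psi>"
| "ksat C R V u (Stit i \<phi>) \<longleftrightarrow> (\<forall>v\<in>C. R i u v \<longrightarrow> ksat C R V v \<phi>)"
| "ksat C R V u (Box \<phi>) \<longleftrightarrow> (\<forall>v\<in>C. ksat C R V v \<phi>)"

text \<open>The last clause is independence of agents, with each cell given by a representative
  \<open>s i\<close>.\<close>

definition stit_frame :: "nat \<Rightarrow> 'a set \<Rightarrow> (nat \<Rightarrow> 'a \<Rightarrow> 'a \<Rightarrow> bool) \<Rightarrow> bool" where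
  "stit_frame n C R \<longleftrightarrow>
     (\<forall>i<n. \<forall>u\<in>C. R i u u) \<and>
     (\<forall>i<n. \<forall>u\<in>C. \<forall>v\<in>C. R i u v \<longrightarrow> R i v u) \<and>
     (\<forall>i<n. \<forall>u\<in>C. \<forall>v\<in>C. \<forall>t\<in>C. R i u v \<longrightarrow> R i v t \<longrightarrow> R i u t) \<and>
     (\<forall>s. (\<forall>i<n. s i \<in> C) \<longrightarrow> (\<exists>t\<in>C. \<forall>i<n. R i (s i) t))"

lemma stit_frame_independence:
  assumes "stit_frame n C R" "\<forall>i<n. s i \<in> C"
  shows "\<exists>t\<in>C. \<forall>i<n. R i (s i) t"
proof -
  have "\<forall>s. (\<forall>i<n. s i \<in> C) \<longrightarrow> (\<exists>t\<in>C. \<forall>i<n. R i (s i) t)"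
    using assms(1) unfolding stit_frame_def by (elim conjE)
  from spec[OF this, of s] assms(2) show ?thesis
    by (rule mp)
qed

text \<open>Agents are added one at a time: if \<open>v\<close> suits all agents below
  \<open>k\<close>, the step for \<open>s k\<close> and \<open>v\<close> gives a world that suits
  \<open>k\<close> and, by transitivity, the earlier agents.\<close>

lemma stepwise_independence:
  fixes n :: nat
  assumes equiv: "\<And>i u. i < n \<Longrightarrow> u \<in> C \<Longrightarrow> R i u u"
    "\<And>i u v t. i < n \<Longrightarrow> u \<in> C \<Longrightarrow> v \<in> C \<Longrightarrow> t \<in> C \<Longrightarrow> R i u v \<Longrightarrow> R i v t \<Longrightarrow> R i u t"
    and step: "\<And>k u v. k < n \<Longrightarrow> k \<ge> 1 \<Longrightarrow> u \<in> C \<Longrightarrow> v \<in> C \<Longrightarrow>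
      \<exists>t\<in>C. R k u t \<and> (\<forall>i<k. R i v t)"
    and "C \<noteq> {}" "\<And>i. i < n \<Longrightarrow> s i \<in> C"
  shows "\<exists>t\<in>C. \<forall>i<n. R i (s i) t"
proof -
  have "\<exists>t\<in>C. \<forall>i<k. R i (s i) t" if "k \<le> n" for k
    using that
  proof (induction k)
    case 0
    then show ?case using assms(4) by auto
  next
    case (Suc k)
    then obtain v where v: "v \<in> C" "\<forall>i<k. R i (s i) v"
      by auto
    have s: "s i \<in> C" if "i \<le> k" for i
      using Suc.prems assms(5) that by auto
    show ?case
    proof (cases "k = 0")
      \<comment> \<open>The step hypothesis starts at \<open>k = 1\<close>; for agent 0 alone,
        \<open>s 0\<close> itself works by reflexivity.\<close>
      case True
      then show ?thesis
        using s[of 0] equiv(1)[of 0] Suc.prems by auto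
    next
      case False
      then obtain t where t: "t \<in> C" "R k (s k) t" "\<forall>i<k. R i v t"
        using step[of k "s k" v] v(1) s Suc.prems by auto
      then have "R i (s i) t" if "i < k" for i
        using equiv(2)[of i "s i" v t] v s that Suc.prems by auto
      with t show ?thesis
        by (auto simp: less_Suc_eq)
    qed
  qed
  then show ?thesis by blast
qed

lemma unprovable_countermodel:
  fixes \<phi> :: "'p::countable fm"
  assumes "\<phi> \<in> lang {..<n}" "\<not> provable {..<n} \<phi>"
  obtains C :: "'p fm set set" and R V x where
    "countable C" "x \<in> C" "stit_frame n C R" "\<not> ksat C R V x \<phi>"
proof -
  let ?A = "{..<n}" and ?R = "\<lambda>i. canon (Stit i)"
  have A: "initial_agents ?A"
    by (auto simp: initial_agents_def)
  have St: "Stit i \<in> boxes ?A" if "i < n" for i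
    using that by (auto simp: boxes_def)
  have Bx: "Box \<in> boxes ?A"
    by (simp add: boxes_def)
  have "consistent ?A {Neg \<phi>}"
    using assms inconsistent_insert_Neg derives_empty by blast
  then obtain x where x: "mcs ?A x" "Neg \<phi> \<in> x"
    using lindenbaum assms(1) by (metis empty_subsetI insert_subset lang_simps(2))
  define S where "S = {u. mcs ?A u \<and> canon Box x u}"
  \<comment> \<open>The hull must keep two kinds of witnesses: worlds refuting \<psi> for each
    modality, where \<open>v\<close> is a dummy parameter, and the worlds supplied by
    \<open>canon_AAIA\<close>. There are countably many conditions since there are countably many
    formulas.\<close>
  define \<P> :: "('p fm set \<Rightarrow> 'p fm set \<Rightarrow> 'p fm set \<Rightarrow> bool) set" where
    "\<P> = (\<lambda>(N, \<psi>) u v t. canon N u t \<and> \<psi> \<notin> t) ` (boxes ?A \<times> UNIV)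
      \<union> (\<lambda>k u v t. ?R k u t \<and> (\<forall>i<k. ?R i v t)) ` ?A"
  have countable: "countable \<P>"
    by (auto simp: \<P>_def boxes_def intro!: countable_Un countable_image countable_SIGMA)
  have xS: "x \<in> S"
    using x(1) canon_refl[OF x(1) Bx] by (simp add: S_def)
  obtain C where C: "countable C" "x \<in> C" "C \<subseteq> S"
    and hull: "\<forall>P\<in>\<P>. \<forall>a\<in>C. \<forall>b\<in>C. \<forall>c\<in>S. P a b c \<longrightarrow> (\<exists>c\<in>C. P a b c)"
    by (rule countable_skolem_hull[OF countable xS])
  have mcs: "mcs ?A u" if "u \<in> C" for u
    using C(3) that by (auto simp: S_def)
  have box: "canon Box u v" if "u \<in> C" "v \<in> C" for u v
    using C(3) that canon_euclidean[OF x(1) _ _ Bx] by (auto simp: S_def)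
  \<comment> \<open>No modality leaves the box-class, so witnesses from the full canonical model lie
    in \<open>S\<close> and the hull property applies to them.\<close>
  have S_closed: "t \<in> S" if "u \<in> C" "mcs ?A t" "N \<in> boxes ?A" "canon N u t" for u t N
  proof -
    have "canon Box u t"
      using that canon_Stit_imp_Box[OF mcs[OF that(1)]] by (auto simp: boxes_def)
    then show ?thesis
      using that C box canon_trans[OF x(1) mcs[OF that(1)] that(2) Bx] by (auto simp: S_def)
  qed
  have witness: "\<exists>v\<in>C. canon N u v \<and> \<psi> \<notin> v"
    if *: "u \<in> C" "N \<in> boxes ?A" "\<psi> \<in> lang ?A" "N \<psi> \<notin> u" for u N \<psi>
  proof -
    obtain v where "mcs ?A v" "canon N u v" "\<psi> \<notin> v"
      using canon_witness[OF mcs[OF *(1)] *(2-4)] by blast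
    moreover have P: "(\<lambda>u v t. canon N u t \<and> \<psi> \<notin> t) \<in> \<P>"
      using *(2) by (force simp: \<P>_def)
    ultimately show ?thesis
      using bspec[OF hull P] S_closed * by blast
  qed
  have step: "\<exists>t\<in>C. ?R k u t \<and> (\<forall>i<k. ?R i v t)"
    if *: "k < n" "k \<ge> 1" "u \<in> C" "v \<in> C" for k u v
  proof -
    obtain t where "mcs ?A t" "?R k u t" "\<forall>i<k. ?R i v t"
      using canon_AAIA[OF A _ *(2) mcs[OF *(3)] mcs[OF *(4)] box[OF *(3,4)]] *(1)
      by (metis lessThan_iff)
    moreover have P: "(\<lambda>u v t. ?R k u t \<and> (\<forall>i<k. ?R i v t)) \<in> \<P>"
      using *(1) by (auto simp: \<P>_def)
    ultimately show ?thesis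
      using bspec[OF hull P] S_closed[OF *(3) _ St] * by blast
  qed
  have refl: "?R i u u" if "i < n" "u \<in> C" for i u
    using canon_refl[OF mcs St] that by blast
  have trans: "?R i u t" if "i < n" "u \<in> C" "v \<in> C" "t \<in> C" "?R i u v" "?R i v t" for i u v t
    using canon_trans[OF mcs mcs mcs St] that by blast
  have frame: "stit_frame n C ?R"
    unfolding stit_frame_def
  proof (intro conjI allI ballI impI)
    show "?R i v u" if "i < n" "u \<in> C" "v \<in> C" "?R i u v" for i u v
      using canon_sym[OF mcs mcs St] that by blast
    show "\<exists>t\<in>C. \<forall>i<n. ?R i (s i) t" if "\<forall>i<n. s i \<in> C" for s
      by (rule stepwise_independence[of n C ?R, OF refl trans step]) (use C(2) that in auto)
    show "?R i u u" if "i < n" "u \<in> C" for i u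
      using that by (rule refl)
    show "?R i u t" if "i < n" "u \<in> C" "v \<in> C" "t \<in> C" "?R i u v" "?R i v t" for i u v t
      using that by (rule trans)
  qed
  let ?V = "\<lambda>p. {u. Atom p \<in> u}"
  \<comment> \<open>The truth lemma survives the passage to \<open>C\<close> because its modal cases
    need only the witnesses kept by the hull.\<close>
  have truth: "ksat C ?R ?V u \<psi> \<longleftrightarrow> \<psi> \<in> u" if "u \<in> C" "\<psi> \<in> lang ?A" for u \<psi>
    using that
  proof (induction \<psi> arbitrary: u)
    case (Neg \<psi>)
    then show ?case by (simp add: mcs_Neg[OF mcs])
  next
    case (And \<psi> \<chi>)
    then show ?case by (simp add: mcs_And[OF mcs])
  next
    case (Stit i \<psi>)
    then have "(\<forall>v\<in>C. ?R i u v \<longrightarrow> \<psi> \<in> v) \<longleftrightarrow> Stit i \<psi> \<in> u"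
      using witness[OF _ St, of u i \<psi>] by (auto simp: canon_def)
    with Stit show ?case by simp
  next
    case (Box \<psi>)
    then have "(\<forall>v\<in>C. \<psi> \<in> v) \<longleftrightarrow> Box \<psi> \<in> u"
      using witness[OF _ Bx, of u \<psi>] box unfolding canon_def lang_simps by blast
    with Box show ?case by simp
  qed simp
  have "\<phi> \<notin> x"
    using x mcs_not_both by blast
  then have "\<not> ksat C ?R ?V x \<phi>"
    using truth[OF C(2) assms(1)] by simp
  then show thesis
    by (rule that[OF C(1,2) frame])
qed


section \<open>Trees of height one\<close>

text \<open>Distinct leaves are incomparable, so every chain lies in some pair of the root and one
  leaf; these pairs are themselves chains.\<close>

lemma Hist_fan:
  assumes "r \<notin> L" "L \<noteq> {}"
  shows "Hist (insert r L) (\<lambda>a b. a = r \<and> b \<in> L) = (\<lambda>l. {r, l}) ` L"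
proof -
  interpret pred_on "insert r L" "\<lambda>a b. a = r \<and> b \<in> L" .
  have chain_pair: "chain {r, l}" if "l \<in> L" for l
    using that by (auto simp: chain_def)
  have chain_sub: "\<exists>l\<in>L. c \<subseteq> {r, l}" if "chain c" for c
  proof (cases "c \<subseteq> {r}")
    case False
    moreover have "c \<subseteq> insert r L"
      using that by (simp add: chain_def)
    ultimately obtain l where l: "l \<in> c" "l \<in> L"
      by blast
    moreover have "c \<subseteq> {r, l}"
      using that l assms(1) unfolding chain_def by blast
    ultimately show ?thesis by blast
  qed (use assms(2) in auto)
  have "maxchain {r, l}" if "l \<in> L" for l
    unfolding maxchain_def
  proof (intro conjI notI chain_pair[OF that], elim exE conjE)
    fix c assume "chain c" "{r, l} \<subset> c"
    with chain_sub obtain l' where "c \<subseteq> {r, l'}" by blast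
    with \<open>{r, l} \<subset> c\<close> assms(1) that show False by auto
  qed
  moreover have "\<exists>l\<in>L. c = {r, l}" if "maxchain c" for c
    using that chain_sub[of c] chain_pair unfolding maxchain_def by blast
  ultimately show ?thesis
    by (auto simp: Hist_def)
qed

text \<open>World \<open>u\<close> becomes the history through the root \<open>r\<close> and the
  leaf \<open>e u\<close>. At \<open>r\<close> the classes of \<open>R i\<close> become the cells of
  agent \<open>i < n\<close>, and independence of the frame becomes independence of choices.\<close>

lemma fan_model:
  fixes C :: "'a set" and r :: 'w
  assumes frame: "stit_frame n C R" and e: "inj_on e C" "r \<notin> e ` C" and "u0 \<in> C"
  obtains M :: "('w, 'p) btac" where "btac_model AGT M" "r \<in> Moments M"
    "\<And>u. u \<in> C \<Longrightarrow> {r, e u} \<in> H_at M r"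
    "\<And>u \<psi>. u \<in> C \<Longrightarrow> \<psi> \<in> lang {..<n} \<Longrightarrow> sat M r {r, e u} \<psi> \<longleftrightarrow> ksat C R V u \<psi>"
proof -
  let ?W = "insert r (e ` C)" and ?lt = "\<lambda>a b. a = r \<and> b \<in> e ` C"
  define hist where "hist u = {r, e u}" for u
  have inj: "u = v" if "u \<in> C" "v \<in> C" "hist u = hist v" for u v
    using that e unfolding hist_def inj_on_def by (metis doubleton_eq_iff image_eqI)
  define cell where "cell i u = hist ` {v \<in> C. R i u v}" for i u
  \<comment> \<open>Agents from \<open>n\<close> on, and all agents at the leaves, have a single
    cell. The valuation is cut down to \<open>C\<close> so that it only mentions actual
    histories.\<close>
  define M :: "('w, 'p) btac" where "M = \<lparr>Moments = ?W, Before = ?lt,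
    Choice = (\<lambda>i w. if w = r \<and> i < n then cell i ` C else {Hist_at ?W ?lt w}),
    Val = (\<lambda>p. {r} \<times> hist ` (V p \<inter> C))\<rparr>"
  have R: "R i u u" "R i u v \<Longrightarrow> R i v u" "R i u v \<Longrightarrow> R i v t \<Longrightarrow> R i u t"
    if "i < n" "u \<in> C" "v \<in> C" "t \<in> C" for i u v t
    using frame that unfolding stit_frame_def by blast+
  have Hist: "Hist ?W ?lt = hist ` C"
    using Hist_fan[OF e(2)] \<open>u0 \<in> C\<close> by (auto simp: hist_def)
  have H_r: "Hist_at ?W ?lt r = hist ` C"
    unfolding Hist_at_def Hist by (auto simp: hist_def)
  have H_ne: "Hist_at ?W ?lt w \<noteq> {}" if "w \<in> ?W" for w
    using that \<open>u0 \<in> C\<close> unfolding Hist_at_def Hist by (auto simp: hist_def)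
  have mem_cell: "hist v \<in> cell i u \<longleftrightarrow> R i u v" if "v \<in> C" for i u v
    using that inj by (auto simp: cell_def)
  have part: "partition_on (hist ` C) (cell i ` C)" if "i < n" for i
  proof (rule partition_onI)
    show "\<Union>(cell i ` C) = hist ` C"
      using R(1)[OF that] by (auto simp: cell_def)
    show "{} \<notin> cell i ` C"
      using R(1)[OF that] by (auto simp: cell_def)
    show "disjnt p q" if pq: "p \<in> cell i ` C" "q \<in> cell i ` C" "p \<noteq> q" for p q
    proof (rule ccontr)
      assume "\<not> disjnt p q"
      from pq obtain u v where u: "u \<in> C" "p = cell i u" and v: "v \<in> C" "q = cell i v"
        by auto
      with \<open>\<not> disjnt p q\<close> obtain h where "h \<in> cell i u" "h \<in> cell i v"
        by (auto simp: disjnt_def)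
      then obtain t where t: "t \<in> C" "R i u t" "R i v t"
        using mem_cell unfolding cell_def by blast
      have "R i u z \<longleftrightarrow> R i v z" if "z \<in> C" for z
        using R[OF \<open>i < n\<close>] u v t that by meson
      then have "p = q"
        unfolding u v cell_def by blast
      with pq show False by blast
    qed
  qed
  have part_M: "partition_on (H_at M w) (Choice M i w)" if "w \<in> ?W" for i w
    using that part H_ne[OF that] by (auto simp: M_def H_r intro!: partition_on_space)
  have model: "btac_model AGT M"
    unfolding btac_model_def
  proof (intro conjI ballI allI impI)
    show "bt_structure (Moments M) (Before M)"
      using e(2) by (auto simp: M_def bt_structure_def irreflp_on_def transp_on_def)
    show "partition_on (H_at M w) (Choice M i w)" if "w \<in> Moments M" for i w
      using that part_M by (simp add: M_def)
    show "Choice M i w \<noteq> {}" for i w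
      using \<open>u0 \<in> C\<close> by (auto simp: M_def)
    show "Val M p \<subseteq> Moments M \<times> Histories M" for p
      by (auto simp: M_def Hist)
    fix w s assume w: "w \<in> Moments M" and s: "\<forall>i\<in>AGT. s i \<in> Choice M i w"
    show "(\<Inter>i\<in>AGT. s i) \<noteq> {}"
    proof (cases "w = r")
      case True
      \<comment> \<open>Frame independence wants a representative for every \<open>i < n\<close>;
        where \<open>i\<close> is not in \<open>AGT\<close>, \<open>u0\<close> is a
        placeholder.\<close>
      have "\<exists>u\<in>C. i \<in> AGT \<longrightarrow> s i = cell i u" if "i < n" for i
        using s True that \<open>u0 \<in> C\<close> by (cases "i \<in> AGT") (force simp: M_def)+
      then obtain f where f: "\<forall>i<n. f i \<in> C \<and> (i \<in> AGT \<longrightarrow> s i = cell i (f i))"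
        by metis
      then obtain t where t: "t \<in> C" "\<forall>i<n. R i (f i) t"
        using stit_frame_independence[OF frame, of f] by blast
      have "hist t \<in> s i" if "i \<in> AGT" for i
      proof (cases "i < n")
        case True
        then show ?thesis
          using f t that by (simp add: mem_cell)
      next
        case False
        then have "s i = hist ` C"
          using s that \<open>w = r\<close> by (auto simp: M_def H_r)
        with t show ?thesis by blast
      qed
      then show ?thesis by blast
    next
      case False
      then have "\<forall>i\<in>AGT. s i = Hist_at ?W ?lt w"
        using s by (simp add: M_def)
      with H_ne w show ?thesis
        by (auto simp: M_def)
    qed
  qed
  have choice: "choice_of M i r (hist u) = cell i u" if "i < n" "u \<in> C" for i u
  proof (rule choice_of_eqI[OF part_M])
    show "cell i u \<in> Choice M i r"
      using that by (auto simp: M_def)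
    show "hist u \<in> cell i u"
      using that R(1) by (simp add: mem_cell)
  qed simp
  have H_M: "H_at M r = hist ` C"
    by (simp add: M_def H_r)
  have truth: "sat M r (hist u) \<psi> \<longleftrightarrow> ksat C R V u \<psi>" if "u \<in> C" "\<psi> \<in> lang {..<n}" for u \<psi>
    using that
  proof (induction \<psi> arbitrary: u)
    case (Atom p)
    then show ?case
      using inj by (auto simp: M_def)
  next
    case (Stit i \<psi>)
    then show ?case
      by (auto simp: choice cell_def)
  qed (auto simp: H_M)
  show thesis
  proof (rule that[OF model])
    show "r \<in> Moments M"
      by (simp add: M_def)
    show "{r, e u} \<in> H_at M r" if "u \<in> C" for u
      using that unfolding H_M by (auto simp: hist_def)
    show "sat M r {r, e u} \<psi> \<longleftrightarrow> ksat C R V u \<psi>" if "u \<in> C" "\<psi> \<in> lang {..<n}" for u \<psi>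
      using truth[OF that] by (simp add: hist_def)
  qed
qed

section \<open>Completeness over an arbitrary infinite type of moments\<close>

lemma btac_valid_imp_ksat:
  fixes \<phi> :: "'p fm"
  assumes "btac_valid TYPE('w::infinite) AGT \<phi>" "\<phi> \<in> lang {..<n}"
    and "countable C" "u \<in> C" "stit_frame n C R"
  shows "ksat C R V u \<phi>"
proof -
  obtain f :: "nat \<Rightarrow> 'w" where f: "inj f"
    using infinite_countable_subset[OF infinite_UNIV] by blast
  \<comment> \<open>The shift by \<open>Suc\<close> reserves \<open>f 0\<close> for the
    root.\<close>
  define e where "e u = f (Suc (to_nat_on C u))" for u
  have e: "inj_on e C" "f 0 \<notin> e ` C"
    using assms(3) by (auto simp: e_def inj_eq[OF f] intro!: inj_onI)
  show ?thesis
  proof (rule fan_model[OF assms(5) e assms(4), of AGT V])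
    fix M :: "('w, 'p) btac"
    assume M: "btac_model AGT M" "f 0 \<in> Moments M" "\<And>u. u \<in> C \<Longrightarrow> {f 0, e u} \<in> H_at M (f 0)"
      and sat: "\<And>u \<psi>. u \<in> C \<Longrightarrow> \<psi> \<in> lang {..<n} \<Longrightarrow>
        sat M (f 0) {f 0, e u} \<psi> \<longleftrightarrow> ksat C R V u \<psi>"
    have "sat M (f 0) {f 0, e u} \<phi>"
      using assms(1) M(1,2) M(3)[OF assms(4)] unfolding btac_valid_def by blast
    with sat[OF assms(4,2)] show ?thesis by simp
  qed
qed

theorem theorem2:
  fixes AGT :: "nat set" and \<phi> :: "'p::{countable,infinite} fm"
  assumes "initial_agents AGT"
    and "\<phi> \<in> lang AGT"
  shows "btac_valid TYPE('w::infinite) AGT \<phi> \<longleftrightarrow> provable AGT \<phi>"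
proof
  assume "provable AGT \<phi>"
  then show "btac_valid TYPE('w) AGT \<phi>"
    unfolding btac_valid_def by (intro allI impI ballI provable_sound[OF _ assms(1)])
next
  assume valid: "btac_valid TYPE('w) AGT \<phi>"
  \<comment> \<open>One more than the largest agent in \<phi>, or 0 if there is none; the second
    inclusion holds because \<open>AGT\<close> is an initial segment.\<close>
  obtain n where n: "agents \<phi> \<subseteq> {..<n}" "{..<n} \<subseteq> AGT"
  proof (cases "agents \<phi> = {}")
    case False
    let ?m = "Max (agents \<phi>)"
    have "?m \<in> AGT"
      using Max_in[OF finite_agents False] assms(2) by (auto simp: lang_def)
    then have "{..<Suc ?m} \<subseteq> AGT"
      using assms(1) by (auto simp: initial_agents_def less_Suc_eq)
    moreover have "agents \<phi> \<subseteq> {..<Suc ?m}"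
      using finite_agents[of \<phi>] by (auto simp: less_Suc_eq_le)
    ultimately show thesis
      using that by blast
  qed (use that[of 0] in auto)
  have L: "\<phi> \<in> lang {..<n}"
    using n(1) by (simp add: lang_def)
  have "provable {..<n} \<phi>"
  proof (rule ccontr)
    assume "\<not> provable {..<n} \<phi>"
    then show False
    proof (rule unprovable_countermodel[OF L])
      fix C :: "'p fm set set" and R V x
      assume "countable C" "x \<in> C" "stit_frame n C R" and sat: "\<not> ksat C R V x \<phi>"
      from btac_valid_imp_ksat[OF valid L this(1-3)] sat show False
        by (rule notE[rotated])
    qed
  qed
  then show "provable AGT \<phi>"
    using n(2) by (rule provable_mono)
qed

end
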